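(* Let $L$ be a lattice generated by a three-element subset $\{a_0,a_1,a_2\}$. Then the following hold. (i) If $L$ has no coatom, then $L$ has at least one atom. (ii) Let $k:=\bigl|\{(i,j)\in\{(0,1),(0,2),(1,2)\}: a_i\wedge a_j\neq a_0\wedge a_1\wedge a_2\}\bigr|$. If $k\in\{2,3\}$, then $L$ has exactly $k$ atoms. (iii) If $L$ is modular, then $L$ has at most three atoms and it has at least one atom.
   Context: A lattice $L$ is generated by a subset $X$ if no proper sublattice of $L$ contains $X$. An element $a\in L$ is an atom if the principal ideal $\{x\in L: x\leq a\}$ has exactly two elements, and it is a coatom if the principal filter $\{x\in L: a\leq x\}$ has exactly two elements. *)

theory Defs
  imports Main
begin

text \<open>A lattice is a type of class \<open>lattice\<close>: its carrier is the whole type.\<close>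

definition sublattice :: "'a::lattice set \<Rightarrow> bool" where
  "sublattice S \<longleftrightarrow> S \<noteq> {} \<and> (\<forall>x\<in>S. \<forall>y\<in>S. inf x y \<in> S \<and> sup x y \<in> S)"

definition generates_lattice :: "'a::lattice set \<Rightarrow> bool" where
  "generates_lattice X \<longleftrightarrow> \<not> (\<exists>S. sublattice S \<and> S \<noteq> UNIV \<and> X \<subseteq> S)"

definition lattice_atom :: "'a::lattice \<Rightarrow> bool" where
  "lattice_atom a \<longleftrightarrow> card {x. x \<le> a} = 2"

definition lattice_coatom :: "'a::lattice \<Rightarrow> bool" where
  "lattice_coatom a \<longleftrightarrow> card {x. a \<le> x} = 2"

definition modular_lattice :: "'a::lattice itself \<Rightarrow> bool" where
  "modular_lattice _ \<longleftrightarrow>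
     (\<forall>x y z :: 'a. x \<le> z \<longrightarrow> sup x (inf y z) = inf (sup x y) z)"

end

theory Submission
  imports Defs
begin

text \<open>
  Write \<open>0 = a \<sqinter> b \<sqinter> c\<close>. Every element \<open>x\<close> of a lattice generated by \<open>a, b, c\<close> satisfies
  \<open>a \<sqinter> b \<le> x\<close> or \<open>x \<le> c\<close>, because the elements with this property form a sublattice containing
  the generators. Hence \<open>a \<sqinter> b\<close> is \<open>0\<close> or an atom, and an atom different from \<open>a \<sqinter> b\<close> lies
  below \<open>c\<close>; this gives (ii). If there are neither atoms nor coatoms, the generators are therefore
  pairwise complementary, so that \<open>{0, a, b, c, 1}\<close> is the whole lattice and \<open>a\<close> is an atom, a
  contradiction; this gives (i). In the modular case with \<open>a \<sqinter> c = b \<sqinter> c = 0\<close>, which by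
  symmetry covers everything outside (ii), put \<open>e = (a \<squnion> b) \<sqinter> (a \<squnion> c) \<sqinter> (b \<squnion> c)\<close>.
  Then every element is above \<open>e\<close> or belongs to an explicit list of ten elements, from which the atoms can be read off.
\<close>

section \<open>Generated lattices, atoms and coatoms\<close>

lemma generates_lattice_induct:
  assumes "generates_lattice X" and "X \<noteq> {}"
    and "\<And>x. x \<in> X \<Longrightarrow> P x"
    and "\<And>x y. P x \<Longrightarrow> P y \<Longrightarrow> P (inf x y)"
    and "\<And>x y. P x \<Longrightarrow> P y \<Longrightarrow> P (sup x y)"
  shows "P x"
proof -
  have "sublattice {x. P x}" "X \<subseteq> {x. P x}"
    using assms unfolding sublattice_def by auto
  with assms(1) have "{x. P x} = UNIV"
    unfolding generates_lattice_def by blast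
  then show ?thesis by blast
qed

text \<open>The least element is a parameter because the class \<open>lattice\<close> supplies
  none.\<close>

lemma lattice_atom_iff:
  assumes "\<And>x. z \<le> (x :: 'a::lattice)"
  shows "lattice_atom p \<longleftrightarrow> p \<noteq> z \<and> (\<forall>x\<le>p. x = z \<or> x = p)"
proof
  assume "lattice_atom p"
  then obtain u v where uv: "{x. x \<le> p} = {u, v}" "u \<noteq> v"
    unfolding lattice_atom_def by (auto simp: card_2_iff)
  moreover have "z \<in> {x. x \<le> p}" "p \<in> {x. x \<le> p}" using assms by auto
  moreover have "p \<noteq> z"
  proof
    assume "p = z"
    then have "\<And>x. x \<in> {x. x \<le> p} \<Longrightarrow> x = z" using assms by (auto intro: antisym)
    with uv show False by blast
  qed
  ultimately have "{x. x \<le> p} = {z, p}" "p \<noteq> z" by auto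
  then show "p \<noteq> z \<and> (\<forall>x\<le>p. x = z \<or> x = p)" by blast
next
  assume "p \<noteq> z \<and> (\<forall>x\<le>p. x = z \<or> x = p)"
  then have "{x. x \<le> p} = {z, p}" "p \<noteq> z" using assms by auto
  then show "lattice_atom p" by (simp add: lattice_atom_def)
qed

lemma lattice_coatomI:
  assumes "\<And>x. x \<le> (u :: 'a::lattice)" "p \<noteq> u" "\<And>x. p \<le> x \<Longrightarrow> x = u \<or> x = p"
  shows "lattice_coatom p"
proof -
  have "{x. p \<le> x} = {u, p}" using assms by auto
  with \<open>p \<noteq> u\<close> show ?thesis by (simp add: lattice_coatom_def)
qed

section \<open>Three generators: symmetry, bounds and complementary generators\<close>

locale three_generated =
  fixes a b c :: "'a::lattice"
  assumes gen: "generates_lattice {a, b, c}"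
    and distinct: "a \<noteq> b" "a \<noteq> c" "b \<noteq> c"
begin

text \<open>Results proved for one labelling of the generators transfer to the others.\<close>

lemma rotate: "three_generated b c a"
  and swap: "three_generated b a c"
  using gen distinct by unfold_locales (auto simp: insert_commute)

definition bottom :: 'a where "bottom = inf (inf a b) c"
definition top_elem :: 'a where "top_elem = sup (sup a b) c"

lemma element_induct [case_names a b c inf sup]:
  assumes "P a" "P b" "P c"
    and "\<And>x y. P x \<Longrightarrow> P y \<Longrightarrow> P (inf x y)"
    and "\<And>x y. P x \<Longrightarrow> P y \<Longrightarrow> P (sup x y)"
  shows "P x"
  using generates_lattice_induct[OF gen, of P x] assms by auto

lemma bottom_le: "bottom \<le> x"
  by (induct x rule: element_induct) (auto simp: bottom_def intro: le_infI1 le_infI2 le_supI1 le_supI2)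

lemma le_top_elem: "x \<le> top_elem"
  by (induct x rule: element_induct) (auto simp: top_elem_def intro: le_infI1 le_infI2 le_supI1 le_supI2)

lemma le_bottom_iff: "x \<le> bottom \<longleftrightarrow> x = bottom"
  using bottom_le by (auto intro: antisym)

lemma inf_le_or_le: "inf a b \<le> x \<or> x \<le> c"
  by (induct x rule: element_induct) (auto intro: le_infI1 le_infI2 le_supI1 le_supI2)

lemma le_or_le_sup: "c \<le> x \<or> x \<le> sup a b"
  by (induct x rule: element_induct) (auto intro: le_infI1 le_infI2 le_supI1 le_supI2)

lemmas atom_iff = lattice_atom_iff[OF bottom_le]

lemma atom_inf:
  assumes "inf a b \<noteq> bottom"
  shows "lattice_atom (inf a b)"
  unfolding atom_iff
proof (intro conjI allI impI assms)
  fix x assume x: "x \<le> inf a b"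
  from inf_le_or_le[of x] show "x = bottom \<or> x = inf a b"
  proof
    assume "x \<le> c"
    with x have "x \<le> bottom" by (simp add: bottom_def)
    then show ?thesis by (simp add: le_bottom_iff)
  qed (use x in \<open>auto intro: antisym\<close>)
qed

lemma coatom_sup:
  assumes "sup a b \<noteq> top_elem"
  shows "lattice_coatom (sup a b)"
proof (rule lattice_coatomI[OF le_top_elem assms])
  fix x assume x: "sup a b \<le> x"
  from le_or_le_sup[of x] show "x = top_elem \<or> x = sup a b"
  proof
    assume "c \<le> x"
    with x have "top_elem \<le> x" by (simp add: top_elem_def)
    then show ?thesis using le_top_elem by (auto intro: antisym)
  qed (use x in \<open>auto intro: antisym\<close>)
qed

lemma atom_cases:
  assumes "lattice_atom p" "inf a b \<noteq> bottom"
  shows "p = inf a b \<or> p \<le> c"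
  using assms inf_le_or_le[of p] unfolding atom_iff by metis

text \<open>A common value of the two meets lies below all three generators. This keeps the atoms
  apart when they are counted.\<close>

lemma inf_pair_inf: "inf a b = inf a c \<Longrightarrow> inf a b = bottom"
  unfolding bottom_def by (metis inf_le1 inf_le2 le_inf_iff inf_absorb1)

text \<open>The bounds are symmetric in the generators, so the rotated interpretations can share one
  \<open>bottom\<close> and one \<open>top_elem\<close>.\<close>

lemma bottom_rotate: "three_generated.bottom b c a = bottom"
  and bottom_swap: "three_generated.bottom b a c = bottom"
  by (simp_all add: bottom_def three_generated.bottom_def[OF rotate]
      three_generated.bottom_def[OF swap] inf_commute inf_left_commute)

lemma top_elem_rotate: "three_generated.top_elem b c a = top_elem"
  by (simp add: top_elem_def three_generated.top_elem_def[OF rotate] sup_commute sup_left_commute)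

interpretation bca: three_generated b c a
  rewrites "three_generated.bottom b c a = bottom"
    and "three_generated.top_elem b c a = top_elem"
  by (rule rotate bottom_rotate top_elem_rotate)+

interpretation cab: three_generated c a b
  rewrites "three_generated.bottom c a b = bottom"
    and "three_generated.top_elem c a b = top_elem"
  using bca.bottom_rotate bca.top_elem_rotate bca.rotate by simp_all

text \<open>If \<open>a\<close> were \<open>bottom\<close>, the joins would give
  \<open>b = top_elem = c\<close>; if \<open>a\<close> were \<open>top_elem\<close>, the meets would
  give \<open>b = bottom = c\<close>.\<close>

lemma distinct_from_bounds:
  assumes "inf a b = bottom" "inf a c = bottom" "sup a b = top_elem" "sup a c = top_elem"
  shows "a \<noteq> bottom" "a \<noteq> top_elem"
  using assms distinct bottom_le le_top_elem by (metis sup_absorb2, metis inf_absorb2)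

lemma atom_if_complementary:
  assumes inf: "inf a b = bottom" "inf a c = bottom" "inf b c = bottom"
    and sup: "sup a b = top_elem" "sup a c = top_elem" "sup b c = top_elem"
  shows "lattice_atom a"
proof -
  note simps = inf inf[THEN trans[OF inf_commute]] sup sup[THEN trans[OF sup_commute]]
    inf_absorb1[OF bottom_le] inf_absorb2[OF bottom_le]
    sup_absorb1[OF bottom_le] sup_absorb2[OF bottom_le]
    inf_absorb1[OF le_top_elem] inf_absorb2[OF le_top_elem]
    sup_absorb1[OF le_top_elem] sup_absorb2[OF le_top_elem]
  have all: "x \<in> {bottom, a, b, c, top_elem}" for x
    by (induct x rule: element_induct) (auto simp: simps)
  note a = distinct_from_bounds[OF inf(1,2) sup(1,2)]
  have "x = bottom \<or> x = a" if "x \<le> a" for x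
  proof -
    \<comment> \<open>For each of the five possible values of \<open>x\<close>, the meet
      \<open>inf x a\<close> is \<open>bottom\<close> or \<open>a\<close>.\<close>
    have "inf x a = x" using that by (simp add: inf_absorb1)
    with all[of x] a show ?thesis by (auto simp: simps)
  qed
  with a show ?thesis unfolding atom_iff by blast
qed

lemma atom_exists_if_no_coatom:
  assumes "\<nexists>u :: 'a. lattice_coatom u"
  shows "\<exists>p :: 'a. lattice_atom p"
proof (rule ccontr)
  assume no: "\<nexists>p :: 'a. lattice_atom p"
  have "inf a b = bottom" "inf a c = bottom" "inf b c = bottom"
    using no atom_inf bca.atom_inf cab.atom_inf by (auto simp: inf_commute)
  moreover have "sup a b = top_elem" "sup a c = top_elem" "sup b c = top_elem"
    using assms coatom_sup bca.coatom_sup cab.coatom_sup by (auto simp: sup_commute)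
  ultimately show False using no atom_if_complementary by blast
qed

section \<open>Counting atoms when two or three pairwise meets are nontrivial\<close>

lemma atoms_two:
  assumes "inf a b \<noteq> bottom" "inf a c \<noteq> bottom" "inf b c = bottom"
  shows "card {p :: 'a. lattice_atom p} = 2"
proof -
  \<comment> \<open>An atom different from both meets lies below \<open>c\<close> and
    \<open>b\<close>, hence below \<open>inf b c = bottom\<close>.\<close>
  have "p = inf a b \<or> p = inf a c" if "lattice_atom p" for p
  proof (rule ccontr)
    assume "\<not> ?thesis"
    with that assms have "p \<le> c" "p \<le> b"
      using atom_cases[of p] cab.atom_cases[of p] by (auto simp: inf_commute)
    then have "p \<le> inf b c" by simp
    with that assms show False by (simp add: le_bottom_iff atom_iff)
  qed
  moreover have "lattice_atom (inf a b)" "lattice_atom (inf a c)"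
    using assms atom_inf cab.atom_inf by (auto simp: inf_commute)
  ultimately have "{p. lattice_atom p} = {inf a b, inf a c}" by blast
  moreover have "inf a b \<noteq> inf a c" using assms inf_pair_inf by blast
  ultimately show ?thesis by simp
qed

lemma atoms_three:
  assumes "inf a b \<noteq> bottom" "inf a c \<noteq> bottom" "inf b c \<noteq> bottom"
  shows "card {p :: 'a. lattice_atom p} = 3"
proof -
  \<comment> \<open>An atom different from all three meets lies below every generator.\<close>
  have "p = inf a b \<or> p = inf a c \<or> p = inf b c" if "lattice_atom p" for p
  proof (rule ccontr)
    assume "\<not> ?thesis"
    with that assms have "p \<le> bottom"
      using atom_cases[of p] bca.atom_cases[of p] cab.atom_cases[of p]
      by (auto simp: bottom_def inf_commute)
    with that show False by (simp add: le_bottom_iff atom_iff)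
  qed
  moreover have "lattice_atom (inf a b)" "lattice_atom (inf a c)" "lattice_atom (inf b c)"
    using assms atom_inf bca.atom_inf cab.atom_inf by (auto simp: inf_commute)
  ultimately have "{p. lattice_atom p} = {inf a b, inf a c, inf b c}" by blast
  moreover have "inf a b \<noteq> inf a c" "inf a b \<noteq> inf b c" "inf a c \<noteq> inf b c"
    using assms inf_pair_inf bca.inf_pair_inf cab.inf_pair_inf by (metis inf_commute)+
  ultimately show ?thesis by simp
qed

section \<open>Atoms among the generators\<close>

lemma atom_cases_median_bottom:
  assumes "inf (inf (sup a b) (sup a c)) (sup b c) = bottom" and "lattice_atom p"
  shows "p = a \<or> p = b \<or> p = c"
proof (rule ccontr)
  assume ne: "\<not> ?thesis"
  \<comment> \<open>Here \<open>g\<close> is a generator and \<open>s\<close> the join of the other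
    two. If the atom \<open>p\<close> is above \<open>g\<close> and different from it, then
    \<open>g = bottom\<close>, so \<open>s\<close> is already \<open>top_elem\<close>. Thus
    \<open>p\<close> lies below all three joins, whose meet is \<open>bottom\<close>.\<close>
  have *: "p \<le> s" if "g \<le> p \<or> p \<le> s" "p \<noteq> g" "top_elem \<le> sup g s" for g s
    using that(1)
  proof
    assume "g \<le> p"
    with assms(2) that(2) have "g = bottom" unfolding atom_iff by blast
    with that(3) have "top_elem \<le> s" by (simp add: sup_absorb2[OF bottom_le])
    then show ?thesis using le_top_elem order_trans by blast
  qed
  have "p \<le> sup a b" using ne by (intro *[OF le_or_le_sup]) (auto simp: top_elem_def le_supI1 le_supI2)
  moreover have "p \<le> sup b c"
    using ne by (intro *[OF bca.le_or_le_sup]) (auto simp: top_elem_def le_supI1 le_supI2)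
  moreover have "p \<le> sup a c"
    using ne by (subst sup_commute, intro *[OF cab.le_or_le_sup]) (auto simp: top_elem_def le_supI1 le_supI2)
  ultimately have "p \<le> bottom" using assms(1) by (metis le_inf_iff)
  with assms(2) show False by (simp add: le_bottom_iff atom_iff)
qed

text \<open>An element below \<open>a\<close> is either also above \<open>a\<close>, or below
  \<open>sup b c\<close> and then below \<open>bottom\<close>.\<close>

lemma atom_generator:
  assumes "inf a (sup b c) = bottom" "a \<noteq> bottom"
  shows "lattice_atom a"
  unfolding atom_iff
proof (intro conjI allI impI assms)
  fix x assume "x \<le> a"
  with bca.le_or_le_sup[of x] show "x = bottom \<or> x = a"
    using assms by (metis antisym le_bottom_iff le_inf_iff)
qed

lemma le_or_inf_le: "a \<le> x \<or> x \<le> sup b c" "b \<le> x \<or> x \<le> sup a c"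
  using bca.le_or_le_sup[of x] cab.le_or_le_sup[of x] by (auto simp: sup_commute)

end

section \<open>Consequences of the modular law\<close>

lemma modular_lattice_sup_inf:
  assumes "modular_lattice TYPE('a::lattice)" and "(x :: 'a) \<le> z"
  shows "inf (sup x y) z = sup x (inf y z)"
  using assms unfolding modular_lattice_def by metis

text \<open>Two applications of the modular law: first with \<open>inf v (sup u w)\<close> below
  \<open>sup v w\<close>, then with \<open>u\<close> below \<open>sup u w\<close>.\<close>

lemma sup_inf_sup_modular:
  assumes "modular_lattice TYPE('a::lattice)"
  shows "sup (inf u (sup v w)) (inf v (sup u w)) = inf (inf (sup u v) (sup u w)) (sup v (w :: 'a))"
proof -
  have "sup (inf v (sup u w)) (inf u (sup v w)) = inf (sup (inf v (sup u w)) u) (sup v w)"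
    by (rule modular_lattice_sup_inf[OF assms, symmetric]) (simp add: le_infI1)
  also have "sup (inf v (sup u w)) u = inf (sup u v) (sup u w)"
    using modular_lattice_sup_inf[OF assms, of u "sup u w" v] by (simp add: sup_commute)
  finally show ?thesis by (simp add: sup_commute)
qed

section \<open>The modular case: the elements not above the median\<close>

locale modular_three_generated = three_generated a b c for a b c :: "'a::lattice" +
  assumes modular: "modular_lattice TYPE('a)"
    and inf_ac: "inf a c = bottom" and inf_bc: "inf b c = bottom"
begin

text \<open>This is the element \<open>e\<close> of the outline. The elements \<open>a1\<close>,
  \<open>b1\<close>, \<open>c1\<close> are the meets of the generators with it.\<close>

definition median :: 'a where "median = inf (inf (sup a b) (sup a c)) (sup b c)"
definition d :: 'a where "d = inf a b"
definition a1 :: 'a where "a1 = inf a (sup b c)"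
definition b1 :: 'a where "b1 = inf b (sup a c)"
definition c1 :: 'a where "c1 = inf c (sup a b)"

text \<open>Since \<open>d\<close> lies below \<open>a1\<close> and \<open>b1\<close>, joining it to
  the elements below \<open>a\<close> or \<open>b\<close> in the list adds nothing beyond these;
  joining it to \<open>c1\<close> and \<open>c\<close> produces the last two entries.\<close>

definition listed :: "'a set" where
  "listed = {bottom, d, a1, a, b1, b, c1, c, sup c1 d, sup c d}"

lemmas defs = d_def a1_def b1_def c1_def

lemma median_eq:
  "median = sup a1 b1" "median = sup a1 c1" "median = sup b1 c1"
  using sup_inf_sup_modular[OF modular, of a b c] sup_inf_sup_modular[OF modular, of a c b]
    sup_inf_sup_modular[OF modular, of b c a]
  by (simp_all add: median_def defs inf_commute sup_commute inf_left_commute)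

lemma order:
  "d \<le> a1" "d \<le> b1" "d \<le> a" "d \<le> b" "a1 \<le> a" "b1 \<le> b" "c1 \<le> c"
  "a1 \<le> median" "b1 \<le> median" "c1 \<le> median" "d \<le> median" "sup c1 d \<le> median"
  "c1 \<le> sup c d" "sup c1 d \<le> sup c d"
  by (auto simp: defs median_def intro: le_infI1 le_infI2 le_supI1 le_supI2)

lemma inf_bottom_if_le:
  "x \<le> a \<Longrightarrow> y \<le> c \<Longrightarrow> inf x y = bottom" "x \<le> b \<Longrightarrow> y \<le> c \<Longrightarrow> inf x y = bottom"
  using inf_mono[of x a y c] inf_mono[of x b y c] by (simp_all add: inf_ac inf_bc le_bottom_iff)

lemma inf_d_if_le:
  assumes "d \<le> x" "d \<le> y" "x \<le> a" "y \<le> b"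
  shows "inf x y = d"
  using assms inf_mono[of x a y b] by (intro antisym) (auto simp: d_def)

text \<open>Since \<open>d \<le> x\<close>, modularity turns \<open>inf (sup d c) x\<close> into
  \<open>sup d (inf c x)\<close>, where \<open>inf c x\<close> is \<open>bottom\<close>.\<close>

lemma inf_sup_c_d: "x \<le> a \<or> x \<le> b \<Longrightarrow> d \<le> x \<Longrightarrow> d \<le> y \<Longrightarrow> y \<le> sup c d \<Longrightarrow> inf x y = d"
proof -
  assume x: "x \<le> a \<or> x \<le> b" "d \<le> x" and y: "d \<le> y" "y \<le> sup c d"
  have "inf x y \<le> inf (sup d c) x" using y by (auto intro: le_infI2 simp: sup_commute)
  also have "\<dots> = sup d (inf c x)" by (rule modular_lattice_sup_inf[OF modular x(2)])
  also have "\<dots> = d" using x(1) inf_bottom_if_le[of x c]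
    by (auto simp: inf_commute sup_absorb1[OF bottom_le])
  finally show "inf x y = d" using x y by (auto intro: antisym)
qed

lemma inf_c_sup: "inf c (sup c1 d) = c1"
  using modular_lattice_sup_inf[OF modular order(7), of d] inf_bottom_if_le[of d c] order
  by (simp add: inf_commute sup_absorb1[OF bottom_le])

text \<open>Either \<open>a \<le> x\<close>, or \<open>x \<le> sup b c\<close> and the meet with
  \<open>a\<close> is squeezed to \<open>a1\<close>; likewise for \<open>b\<close> and
  \<open>c\<close>. The last claim reduces to the one for \<open>c\<close> by modularity, as
  \<open>d \<le> x\<close>.\<close>

lemma inf_above_median:
  assumes x: "median \<le> x"
  shows "inf x a \<in> {a1, a}" "inf x b \<in> {b1, b}" "inf x c \<in> {c1, c}"
    "inf x (sup c d) \<in> {sup c1 d, sup c d}"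
proof -
  have le: "a1 \<le> x" "b1 \<le> x" "c1 \<le> x" "d \<le> x" using order x by (auto intro: order_trans)
  show "inf x a \<in> {a1, a}"
    using le_or_inf_le(1)[of x] le order by (auto simp: inf_absorb2 a1_def intro!: antisym intro: le_infI1 le_infI2)
  show "inf x b \<in> {b1, b}"
    using le_or_inf_le(2)[of x] le order by (auto simp: inf_absorb2 b1_def intro!: antisym intro: le_infI1 le_infI2)
  show c: "inf x c \<in> {c1, c}"
    using le_or_le_sup[of x] le order by (auto simp: inf_absorb2 c1_def intro!: antisym intro: le_infI1 le_infI2)
  show "inf x (sup c d) \<in> {sup c1 d, sup c d}"
    using modular_lattice_sup_inf[OF modular le(4), of c] c
    by (auto simp: inf_commute sup_commute)
qed

lemma inf_above_median_listed:
  assumes "median \<le> x" "y \<in> listed"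
  shows "inf x y \<in> listed"
proof -
  have "a1 \<le> x" "b1 \<le> x" "c1 \<le> x" "d \<le> x" "sup c1 d \<le> x"
    using order assms(1) by (auto intro: order_trans)
  with inf_above_median[OF assms(1)] assms(2) show ?thesis
    by (auto simp: listed_def inf_absorb2 bottom_le)
qed

lemma inf_listed:
  assumes "x \<in> listed" "y \<in> listed"
  shows "inf x y \<in> listed"
proof -
  have eqs: "inf d c1 = bottom" "inf d c = bottom"
    "inf a1 c1 = bottom" "inf a1 c = bottom" "inf a c1 = bottom" "inf a c = bottom"
    "inf b1 c1 = bottom" "inf b1 c = bottom" "inf b c1 = bottom" "inf b c = bottom"
    by (auto intro: inf_bottom_if_le simp: order)
  have eqs2: "inf a1 b1 = d" "inf a1 b = d" "inf a b1 = d" "inf a b = d"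
    by (auto intro: inf_d_if_le simp: order)
  have eqs3: "inf a1 (sup c1 d) = d" "inf a1 (sup c d) = d" "inf a (sup c1 d) = d" "inf a (sup c d) = d"
    "inf b1 (sup c1 d) = d" "inf b1 (sup c d) = d" "inf b (sup c1 d) = d" "inf b (sup c d) = d"
    by (auto intro!: inf_sup_c_d simp: order)
  have eqs4: "inf d a1 = d" "inf d a = d" "inf d b1 = d" "inf d b = d" "inf a1 a = a1" "inf b1 b = b1"
    "inf c1 c = c1" "inf c1 (sup c d) = c1" "inf (sup c1 d) (sup c d) = sup c1 d"
    by (simp_all add: order inf_absorb1)
  have eqs5: "inf d (sup c1 d) = d" "inf d (sup c d) = d" "inf c1 (sup c1 d) = c1" "inf c (sup c d) = c"
    by (simp_all add: inf_absorb1)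
  note all = eqs eqs2 eqs3 eqs4 eqs5 inf_c_sup
  show ?thesis
    using assms unfolding listed_def
    by (elim insertE emptyE; simp only: all all[THEN trans[OF inf_commute]] inf_idem
        inf_absorb1[OF bottom_le] inf_absorb2[OF bottom_le]; blast)
qed

lemma sup_listed:
  assumes "x \<in> listed" "y \<in> listed"
  shows "sup x y \<in> listed \<or> median \<le> sup x y"
proof -
  \<comment> \<open>Any two of \<open>a1\<close>, \<open>b1\<close>, \<open>c1\<close> already have
    join \<open>median\<close>.\<close>
  have med: "median \<le> sup x y"
    if "a1 \<le> x \<and> b1 \<le> y \<or> a1 \<le> x \<and> c1 \<le> y \<or> b1 \<le> x \<and> c1 \<le> y" for x y
    using that median_eq by (metis sup_mono)
  have eqs: "sup d a1 = a1" "sup d a = a" "sup d b1 = b1" "sup d b = b" "sup a1 a = a" "sup b1 b = b"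
    "sup c1 c = c" "sup c1 (sup c d) = sup c d" "sup (sup c1 d) (sup c d) = sup c d"
    by (simp_all add: order sup_absorb2)
  have eqs2: "sup d (sup c1 d) = sup c1 d" "sup d (sup c d) = sup c d"
     "sup c1 (sup c1 d) = sup c1 d" "sup c (sup c d) = sup c d"
    by (simp_all add: sup_commute sup_left_commute)
  have eqs3: "sup c (sup c1 d) = sup c d"
    using order by (simp add: sup_assoc[symmetric] sup_absorb1)
  note all = eqs eqs2 eqs3
  \<comment> \<open>Elements of \<open>A\<close>, \<open>B\<close>, \<open>C\<close> lie above
    \<open>a1\<close>, \<open>b1\<close>, \<open>c1\<close> respectively. Joins across two of these
    groups are therefore above \<open>median\<close>, while joins within one group, enlarged by
    \<open>L\<close>, stay in the list.\<close>
  define L A B C where sets: "L = {bottom, d}" "A = {a1, a}" "B = {b1, b}"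
    "C = {c1, c, sup c1 d, sup c d}"
  have above: "a1 \<le> u" if "u \<in> A" for u using that order by (auto simp: sets)
  have above': "b1 \<le> u" if "u \<in> B" for u using that order by (auto simp: sets)
  have above'': "c1 \<le> u" if "u \<in> C" for u using that order by (auto simp: sets)
  have same: "sup x y \<in> listed" if "x \<in> L \<union> S" "y \<in> L \<union> S" "S = A \<or> S = B \<or> S = C" for S
    using that(3,1,2) unfolding listed_def sets
    by (elim disjE; simp only: Un_iff insert_iff empty_iff simp_thms; elim disjE;
        simp only: all all[THEN trans[OF sup_commute]] sup_commute[of d c1] sup_commute[of d c]
          sup_idem sup_absorb1[OF bottom_le] sup_absorb2[OF bottom_le] simp_thms)
  have "x \<in> L \<or> x \<in> A \<or> x \<in> B \<or> x \<in> C" "y \<in> L \<or> y \<in> A \<or> y \<in> B \<or> y \<in> C"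
    using assms unfolding listed_def sets by blast+
  then consider "x \<in> L \<union> A" "y \<in> L \<union> A" | "x \<in> L \<union> B" "y \<in> L \<union> B" | "x \<in> L \<union> C" "y \<in> L \<union> C"
    | "x \<in> A" "y \<in> B" | "x \<in> A" "y \<in> C" | "x \<in> B" "y \<in> C"
    | "y \<in> A" "x \<in> B" | "y \<in> A" "x \<in> C" | "y \<in> B" "x \<in> C"
    by blast
  then show ?thesis
  proof cases
    case 1 then show ?thesis using same by blast
  next
    case 2 then show ?thesis using same by blast
  next
    case 3 then show ?thesis using same by blast
  qed (use med[of x y] med[of y x] above above' above'' in \<open>simp_all add: sup_commute[of y x]\<close>)
qed

lemma median_le_or_listed: "median \<le> x \<or> x \<in> listed"
proof (induct x rule: element_induct)
  case (inf x y)
  then show ?case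
    using inf_listed inf_above_median_listed[of x y] inf_above_median_listed[of y x]
    by (auto simp: inf_commute)
next
  case (sup x y)
  then show ?case using sup_listed by (auto intro: le_supI1 le_supI2)
qed (simp_all add: listed_def)

section \<open>Atoms in the modular case\<close>

lemma atoms_if_inf_nonbottom:
  assumes "d \<noteq> bottom" "lattice_atom p"
  shows "p \<in> {d, c, c1}"
proof (cases "p = d")
  case False
  \<comment> \<open>Being below \<open>c\<close> and different from \<open>d\<close>, the atom is
    neither above \<open>d\<close> nor below \<open>a\<close> or \<open>b\<close>. This excludes
    everything above \<open>median\<close> and all listed elements except \<open>c\<close> and
    \<open>c1\<close>.\<close>
  then have pc: "p \<le> c" using atom_cases[OF assms(2)] assms(1) by (auto simp: d_def)
  have "p \<noteq> bottom" using assms(2) unfolding atom_iff by blast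
  moreover have "\<not> d \<le> p"
    using assms pc unfolding atom_iff by (metis False)
  moreover have "\<not> p \<le> a" "\<not> p \<le> b"
    using inf_bottom_if_le[of p p] pc calculation by auto
  ultimately show ?thesis
    using median_le_or_listed[of p] pc order False
    by (auto simp: listed_def intro: order_trans)
qed simp

text \<open>The three elements have pairwise meet \<open>bottom\<close> and pairwise join
  \<open>median\<close>. If one were \<open>bottom\<close>, the other two would both equal
  \<open>median\<close>, so their meet would give \<open>median = bottom\<close>.\<close>

lemma middle_nonbottom:
  assumes "median \<noteq> bottom" "d = bottom"
  shows "a1 \<noteq> bottom" "b1 \<noteq> bottom" "c1 \<noteq> bottom"
proof -
  have "inf a1 b1 = bottom" "inf a1 c1 = bottom" "inf b1 c1 = bottom"
    using inf_d_if_le[of a1 b1] assms(2) order by (auto intro: inf_bottom_if_le)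
  then show "a1 \<noteq> bottom" "b1 \<noteq> bottom" "c1 \<noteq> bottom"
    using assms(1) median_eq bottom_le by (metis sup_absorb1 sup_absorb2 inf_idem)+
qed

text \<open>Every element other than \<open>bottom\<close> is above one of \<open>a1\<close>,
  \<open>b1\<close>, \<open>c1\<close>, none of which is \<open>bottom\<close>.\<close>

lemma atoms_if_median_nonbottom:
  assumes "median \<noteq> bottom" "d = bottom" "lattice_atom p"
  shows "p \<in> {a1, b1, c1}"
proof -
  note nb = middle_nonbottom[OF assms(1,2)]
  have below: "x = p" if "x \<le> p" "x \<noteq> bottom" for x
    using that assms(3) unfolding atom_iff by blast
  from median_le_or_listed[of p] show ?thesis
  proof
    assume "median \<le> p"
    then show ?thesis using below[OF _ nb(1)] order by (metis insertI1 order_trans)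
  next
    assume "p \<in> listed"
    moreover have "p \<noteq> bottom" using assms(3) unfolding atom_iff by blast
    ultimately show ?thesis
      using below[OF _ nb(1)] below[OF _ nb(2)] below[OF _ nb(3)] order assms(2)
      by (auto simp: listed_def sup_absorb1[OF bottom_le])
  qed
qed

lemma atom_if_median_nonbottom:
  assumes "median \<noteq> bottom" "d = bottom"
  shows "lattice_atom a1"
  unfolding atom_iff
proof (intro conjI allI impI middle_nonbottom[OF assms])
  note nb = middle_nonbottom[OF assms]
  fix x assume x: "x \<le> a1"
  then have xa: "x \<le> a" using order by (auto intro: order_trans)
  \<comment> \<open>Otherwise \<open>b1 \<le> a1\<close>, which collapses \<open>b1\<close> to
    \<open>d = bottom\<close>.\<close>
  have "\<not> median \<le> x"
  proof
    assume "median \<le> x"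
    with x order have "b1 \<le> a1" by (metis order_trans)
    then have "b1 = d" using inf_d_if_le[of a1 b1] order by (simp add: inf_absorb2)
    with nb assms show False by simp
  qed
  then have "x \<in> listed" using median_le_or_listed by blast
  moreover have "x = bottom" if "x \<le> b"
    using that xa bottom_le assms(2) by (auto simp: d_def[symmetric] le_bottom_iff[symmetric] dest: le_infI[of x a b])
  moreover have "x = bottom" if "x \<le> c"
    using inf_bottom_if_le(1)[OF xa that] by simp
  ultimately show "x = bottom \<or> x = a1"
    using x order assms(2) by (auto simp: listed_def sup_absorb1[OF bottom_le] intro: antisym)
qed

lemma atoms_modular:
  "finite {p :: 'a. lattice_atom p} \<and> card {p :: 'a. lattice_atom p} \<le> 3 \<and> (\<exists>p :: 'a. lattice_atom p)"
proof -
  have three: "finite A \<and> card A \<le> 3" if "A \<subseteq> {x, y, z}" for A and x y z :: 'a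
    using that card_mono[of "{x, y, z}" A] finite_subset[OF that] card_insert_le_m1[of 3 "{y,z}" x]
    by (auto simp: card_insert_if split: if_splits)
  consider "d \<noteq> bottom" | "d = bottom" "median \<noteq> bottom" | "d = bottom" "median = bottom" by blast
  then show ?thesis
  proof cases
    case 1
    then have "{p. lattice_atom p} \<subseteq> {d, c, c1}" using atoms_if_inf_nonbottom by blast
    then show ?thesis using 1 atom_inf three by (auto simp: d_def)
  next
    case 2
    then have "{p. lattice_atom p} \<subseteq> {a1, b1, c1}" using atoms_if_median_nonbottom by blast
    then show ?thesis using 2 atom_if_median_nonbottom three by blast
  next
    case 3
    then have "{p. lattice_atom p} \<subseteq> {a, b, c}"
      using atom_cases_median_bottom unfolding median_def by blast
    moreover have "\<exists>p :: 'a. lattice_atom p"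
    proof -
      \<comment> \<open>Since \<open>a\<close> and \<open>b\<close> are distinct, one of them is not
        \<open>bottom\<close> and is then an atom; swapping them handles \<open>b\<close>.\<close>
      interpret bac: three_generated b a c rewrites "three_generated.bottom b a c = bottom"
        by (rule swap bottom_swap)+
      have "a1 = bottom" "b1 = bottom"
        using 3 order by (metis le_bottom_iff)+
      then show ?thesis
        using atom_generator bac.atom_generator distinct(1) unfolding a1_def b1_def by metis
    qed
    ultimately show ?thesis using three by blast
  qed
qed

end

section \<open>From indexed generators to the three labellings\<close>

theorem mainTheorem2:
  fixes a :: "nat \<Rightarrow> 'a::lattice"
  assumes three: "card (a ` {0, 1, 2}) = 3"
    and gen: "generates_lattice (a ` {0, 1, 2})"
  shows "(\<not> (\<exists>c::'a. lattice_coatom c) \<longrightarrow> (\<exists>p::'a. lattice_atom p)) \<and>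
    (let k = card {(i, j) \<in> {(0::nat, 1::nat), (0, 2), (1, 2)}.
                     inf (a i) (a j) \<noteq> inf (inf (a 0) (a 1)) (a 2)}
     in k \<in> {2, 3} \<longrightarrow> card {p::'a. lattice_atom p} = k) \<and>
    (modular_lattice TYPE('a) \<longrightarrow>
       finite {p::'a. lattice_atom p} \<and> card {p::'a. lattice_atom p} \<le> 3 \<and>
       (\<exists>p::'a. lattice_atom p))"
proof -
  let ?a = "a 0" and ?b = "a 1" and ?c = "a 2"
  let ?o = "inf (inf (a 0) (a 1)) (a 2)"
  interpret abc: three_generated "a 0" "a 1" "a 2"
    using three gen by unfold_locales (auto simp: card_insert_if split: if_splits)
  interpret bca: three_generated "a 1" "a 2" "a 0" by (rule abc.rotate)
  interpret cab: three_generated "a 2" "a 0" "a 1" by (rule bca.rotate)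
  have o: "abc.bottom = ?o" "bca.bottom = ?o" "cab.bottom = ?o"
    unfolding abc.bottom_def bca.bottom_def cab.bottom_def
    by (simp_all add: inf_commute inf_left_commute)
  let ?K = "{(i, j) \<in> {(0::nat, 1::nat), (0, 2), (1, 2)}. inf (a i) (a j) \<noteq> ?o}"
  have K: "?K = (if inf ?a ?b \<noteq> ?o then {(0, 1)} else {}) \<union>
      (if inf ?a ?c \<noteq> ?o then {(0, 2)} else {}) \<union> (if inf ?b ?c \<noteq> ?o then {(1, 2)} else {})"
    by auto
  have ii: "card {p :: 'a. lattice_atom p} = card ?K" if "card ?K \<in> {2, 3}"
    using that abc.atoms_two bca.atoms_two cab.atoms_two abc.atoms_three
    unfolding K o by (auto simp: inf_commute split: if_splits)
  have iii: "finite {p :: 'a. lattice_atom p} \<and> card {p :: 'a. lattice_atom p} \<le> 3 \<and>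
      (\<exists>p :: 'a. lattice_atom p)" if modular: "modular_lattice TYPE('a)"
  proof (cases "card ?K \<in> {2, 3}")
    case True
    with ii have card: "card {p :: 'a. lattice_atom p} \<in> {2, 3}" by simp
    \<comment> \<open>An infinite set has \<open>card\<close> 0, so the value 2 or 3 also yields
      finiteness and an atom.\<close>
    then have "finite {p :: 'a. lattice_atom p}" "{p :: 'a. lattice_atom p} \<noteq> {}"
      by (auto intro: card_ge_0_finite simp del: Collect_empty_eq)
    then show ?thesis using card by auto
  next
    case False
    \<comment> \<open>At most one pairwise meet differs from \<open>?o\<close>. The other two share
      a generator, which takes the place of \<open>c\<close> in the modular locale.\<close>
    then have "inf ?a ?c = ?o \<and> inf ?b ?c = ?o \<or> inf ?b ?a = ?o \<and> inf ?c ?a = ?o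
        \<or> inf ?c ?b = ?o \<and> inf ?a ?b = ?o"
      unfolding K by (auto simp: inf_commute split: if_splits)
    then have "modular_three_generated ?a ?b ?c \<or> modular_three_generated ?b ?c ?a
        \<or> modular_three_generated ?c ?a ?b"
      using modular abc.three_generated_axioms bca.three_generated_axioms cab.three_generated_axioms
      unfolding modular_three_generated_def modular_three_generated_axioms_def o by blast
    then show ?thesis by (blast dest: modular_three_generated.atoms_modular)
  qed
  show ?thesis
    using abc.atom_exists_if_no_coatom ii iii by (simp only: Let_def) blast
qed

end
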